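(* Let $X$ be a finite dimensional Banach space over $\mathbb K\in\{\mathbb R,\mathbb C\}$, let $\mathcal S=(S_n)_{n\in\mathbb Z}$ be a sequence of invertible linear operators on $X$ for which there is $C_0>0$ with $\|S_n\|,\|S_n^{-1}\|<C_0$ for all $n\in\mathbb Z$, and let $\mathcal E$ be a basis of $X$ with $\mathcal S$-bounded projections. Then, for each $1\le p<+\infty$, the shift operator $\sigma_{\mathcal S}\colon\ell_p(X)\to\ell_p(X)$ is conjugate to the finite product of weighted backward shifts $\prod_{x\in\mathcal E}B_{\omega(x)}\colon(\ell_p(\mathbb K))^{\dim X}\to(\ell_p(\mathbb K))^{\dim X}$.
   Context: $\ell_p(Y)$ is the Banach space of bilateral sequences $(y_n)_{n\in\mathbb Z}$ in $Y$ with $\|(y_n)\|_p=(\sum_{n\in\mathbb Z}\|y_n\|^p)^{1/p}<\infty$; finite products of copies of $\ell_p(\mathbb K)$ carry the sum norm. Shift operator: $\sigma_{\mathcal S}((x_n)_{n\in\mathbb Z})=(S_{n+1}(x_{n+1}))_{n\in\mathbb Z}$. For a sequence $\omega=(\omega_n)_{n\in\mathbb Z}$ of scalars bounded and bounded away from $0$, the weighted backward shift is $B_\omega((t_n)_{n\in\mathbb Z})=(\omega_{n+1}t_{n+1})_{n\in\mathbb Z}$. For $n,m\in\mathbb Z$ let $S_{[n,m]}=S_n\circ S_{n+1}\circ\cdots\circ S_m$ if $n<m$, $S_{[n,n]}=S_n$, and $S_{[n,m]}=\mathrm{Id}$ if $n>m$. For $x\in X\setminus\{0\}$ define $\omega(x)=(\omega_n(x))_{n\in\mathbb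 Z}$ by $$\omega_n(x)=\frac{\|(S_{[1,n-1]})^{-1}(x)\|}{\|(S_{[1,n]})^{-1}(x)\|}\ (n>0),\qquad \omega_n(x)=\frac{\|S_{[n,0]}(x)\|}{\|S_{[n+1,0]}(x)\|}\ (n\le 0),$$ and the unit vectors $$e_n(x)=\frac{(S_{[1,n]})^{-1}(x)}{\|(S_{[1,n]})^{-1}(x)\|}\ (n\ge0),\qquad e_n(x)=\frac{S_{[n+1,0]}(x)}{\|S_{[n+1,0]}(x)\|}\ (n<0).$$ $\mathcal S$-bounded projections: for a basis $\mathcal E$ of $X$ put $\mathcal E_n=\{e_n(x)\colon x\in\mathcal E\}$, which is a basis of $X$ for each $n\in\mathbb Z$. For $b\in\mathcal E_n$ let $\Pi_b\colon X\to\mathrm{span}\{b\}$ be the projection along the other elements of $\mathcal E_n$, i.e. $\Pi_b(\sum_{c\in\mathcal E_n}\alpha_c c)=\alpha_b b$. The basis $\mathcal E$ has $\mathcal S$-bounded projections if $\sup_{n\in\mathbb Z}\sup_{b\in\mathcal E_n}\|\Pi_b\|<+\infty$. Conjugate: bounded linear operators $T\colon Y\to Y$ and $R\colon Z\to Z$ on Banach spaces are conjugate if there is a bounded invertible linear operator (with bounded inverse) $H\colon Y\to Z$ with $H\circ T=R\circ H$. *)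

theory Defs
  imports "HOL-Analysis.Analysis"
begin

text \<open>The scalar field \<open>\<bbbK> \<in> {\<real>, \<complex>}\<close>: the class axiom leaves exactly these two fields, and
  multiplicativity of the norm leaves only the usual absolute value on them.\<close>

class real_or_complex = real_normed_field +
  assumes real_or_complex:
    "(\<forall>z. \<exists>a. z = a *\<^sub>R 1) \<or>
     (\<exists>j. j * j = - 1 \<and> (\<forall>z. \<exists>a b. z = a *\<^sub>R 1 + b *\<^sub>R j))"

instance real :: real_or_complex
  by standard simp

instance complex :: real_or_complex
proof
  have "\<forall>z. \<exists>a b. z = a *\<^sub>R 1 + b *\<^sub>R \<i>"
    by (metis complex_eq mult.commute of_real_def scaleR_conv_of_real)
  then show "(\<forall>z::complex. \<exists>a. z = a *\<^sub>R 1) \<or>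
      (\<exists>j::complex. j * j = - 1 \<and> (\<forall>z. \<exists>a b. z = a *\<^sub>R 1 + b *\<^sub>R j))"
    using i_squared by blast
qed

text \<open>A normed space over \<open>\<bbbK>\<close>. The real structure carried by the type class is the
  restriction of the scalar multiplication \<open>sc\<close> to \<open>\<real> \<subseteq> \<bbbK>\<close>.\<close>

locale normed_vector_space = vector_space sc
  for sc :: "'k::real_or_complex \<Rightarrow> 'x::real_normed_vector \<Rightarrow> 'x" +
  assumes norm_scale: "norm (sc a x) = norm a * norm x"
    and scale_of_real: "sc (of_real r) x = r *\<^sub>R x"


subsection \<open>Normed spaces with explicit carrier and their operators\<close>

record ('k, 'v) nspace =
  pts :: "'v set"
  add :: "'v \<Rightarrow> 'v \<Rightarrow> 'v"
  smul :: "'k \<Rightarrow> 'v \<Rightarrow> 'v"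
  nrm :: "'v \<Rightarrow> real"

definition bounded_operator :: "('k, 'v) nspace \<Rightarrow> ('k, 'w) nspace \<Rightarrow> ('v \<Rightarrow> 'w) \<Rightarrow> bool"
  where "bounded_operator Y Z T \<longleftrightarrow>
    T \<in> pts Y \<rightarrow> pts Z \<and>
    (\<forall>u\<in>pts Y. \<forall>v\<in>pts Y. T (add Y u v) = add Z (T u) (T v)) \<and>
    (\<forall>a. \<forall>u\<in>pts Y. T (smul Y a u) = smul Z a (T u)) \<and>
    (\<exists>C. \<forall>u\<in>pts Y. nrm Z (T u) \<le> C * nrm Y u)"

definition conjugate_operators ::
    "('k, 'v) nspace \<Rightarrow> ('v \<Rightarrow> 'v) \<Rightarrow> ('k, 'w) nspace \<Rightarrow> ('w \<Rightarrow> 'w) \<Rightarrow> bool"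
  where "conjugate_operators Y T Z R \<longleftrightarrow>
    bounded_operator Y Y T \<and> bounded_operator Z Z R \<and>
    (\<exists>H. bounded_operator Y Z H \<and> bij_betw H (pts Y) (pts Z) \<and>
         bounded_operator Z Y (inv_into (pts Y) H) \<and>
         (\<forall>y\<in>pts Y. H (T y) = R (H y)))"

definition lp_space ::
    "real \<Rightarrow> ('k \<Rightarrow> 'y \<Rightarrow> 'y) \<Rightarrow> ('k, int \<Rightarrow> 'y::real_normed_vector) nspace"
  where "lp_space p sc =
    \<lparr> pts = {y. (\<lambda>n. norm (y n) powr p) summable_on UNIV},
      add = (\<lambda>y z n. y n + z n),
      smul = (\<lambda>a y n. sc a (y n)),
      nrm = (\<lambda>y. (\<Sum>\<^sub>\<infinity>n. norm (y n) powr p) powr (1 / p)) \<rparr>"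

text \<open>The product of copies of \<open>Y\<close> indexed by \<open>I\<close>, with the sum norm; families are
  \<^const>\<open>undefined\<close> outside \<open>I\<close>, as usual for \<^const>\<open>PiE\<close>.\<close>

definition product_space :: "'i set \<Rightarrow> ('k, 'v) nspace \<Rightarrow> ('k, 'i \<Rightarrow> 'v) nspace"
  where "product_space I Y =
    \<lparr> pts = I \<rightarrow>\<^sub>E pts Y,
      add = (\<lambda>f g. \<lambda>i\<in>I. add Y (f i) (g i)),
      smul = (\<lambda>a f. \<lambda>i\<in>I. smul Y a (f i)),
      nrm = (\<lambda>f. \<Sum>i\<in>I. nrm Y (f i)) \<rparr>"

definition product_operator :: "'i set \<Rightarrow> ('i \<Rightarrow> 'v \<Rightarrow> 'v) \<Rightarrow> ('i \<Rightarrow> 'v) \<Rightarrow> 'i \<Rightarrow> 'v"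
  where "product_operator I T f = (\<lambda>i\<in>I. T i (f i))"


subsection \<open>Shifts\<close>

definition shift_operator :: "(int \<Rightarrow> 'x \<Rightarrow> 'x) \<Rightarrow> (int \<Rightarrow> 'x) \<Rightarrow> int \<Rightarrow> 'x"
  where "shift_operator S x = (\<lambda>n. S (n + 1) (x (n + 1)))"

definition weighted_backward_shift :: "(int \<Rightarrow> 'k::times) \<Rightarrow> (int \<Rightarrow> 'k) \<Rightarrow> int \<Rightarrow> 'k"
  where "weighted_backward_shift \<omega> t = (\<lambda>n. \<omega> (n + 1) * t (n + 1))"

text \<open>\<open>S\<^bsub>[n,m]\<^esub> = S\<^sub>n \<circ> \<dots> \<circ> S\<^sub>m\<close>; the list \<open>[n..m]\<close> is empty if \<open>n > m\<close>.\<close>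

definition comp_between :: "(int \<Rightarrow> 'x \<Rightarrow> 'x) \<Rightarrow> int \<Rightarrow> int \<Rightarrow> 'x \<Rightarrow> 'x"
  where "comp_between S n m = foldr (\<circ>) (map S [n..m]) id"

definition weight :: "(int \<Rightarrow> 'x \<Rightarrow> 'x) \<Rightarrow> 'x::real_normed_vector \<Rightarrow> int \<Rightarrow> real"
  where "weight S x n =
    (if n > 0 then norm (inv (comp_between S 1 (n - 1)) x) / norm (inv (comp_between S 1 n) x)
     else norm (comp_between S n 0 x) / norm (comp_between S (n + 1) 0 x))"

definition orbit_vector :: "(int \<Rightarrow> 'x \<Rightarrow> 'x) \<Rightarrow> int \<Rightarrow> 'x::real_normed_vector \<Rightarrow> 'x"
  where "orbit_vector S n x =
    (if n \<ge> 0 then inv (comp_between S 1 n) x /\<^sub>R norm (inv (comp_between S 1 n) x)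
     else comp_between S (n + 1) 0 x /\<^sub>R norm (comp_between S (n + 1) 0 x))"


subsection \<open>Bounded projections\<close>

text \<open>\<^term>\<open>module.representation sc B v b\<close> is the coefficient of \<open>b\<close> in the expansion
  of \<open>v\<close> in the basis \<open>B\<close>.\<close>

definition coordinate_projection ::
    "('k::field \<Rightarrow> 'x::ab_group_add \<Rightarrow> 'x) \<Rightarrow> 'x set \<Rightarrow> 'x \<Rightarrow> 'x \<Rightarrow> 'x"
  where "coordinate_projection sc B b v = sc (module.representation sc B v b) b"

definition has_bounded_projections ::
    "('k::field \<Rightarrow> 'x::real_normed_vector \<Rightarrow> 'x) \<Rightarrow> (int \<Rightarrow> 'x \<Rightarrow> 'x) \<Rightarrow> 'x set \<Rightarrow> bool"
  where "has_bounded_projections sc S E \<longleftrightarrow>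
    bdd_above {onorm (coordinate_projection sc (orbit_vector S n ` E) b) | n b.
      b \<in> orbit_vector S n ` E}"

end

theory Submission
  imports Defs
begin

text \<open>
  For each \<open>x \<in> E\<close> the line through \<open>x\<close> has a full orbit \<open>A\<^sub>n x\<close> under the cocycle, where
  \<open>S\<^sub>n \<circ> A\<^sub>n = A\<^sub>n\<^sub>-\<^sub>1\<close> and \<open>A\<^sub>0 = id\<close>: for \<open>n > 0\<close> one pulls back along inverses, for \<open>n < 0\<close> one
  pushes forward.  The unit vectors \<open>e\<^sub>n(x)\<close> are the normalised orbit points, and the weight
  \<open>\<omega>\<^sub>n(x) = \<parallel>A\<^sub>n\<^sub>-\<^sub>1 x\<parallel> / \<parallel>A\<^sub>n x\<parallel>\<close> is exactly what makes \<open>S\<^sub>n e\<^sub>n(x) = \<omega>\<^sub>n(x) e\<^sub>n\<^sub>-\<^sub>1(x)\<close> true.  So in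
  the moving frame \<open>n \<mapsto> (e\<^sub>n(x))\<^sub>x\<close> every \<open>S\<^sub>n\<close> is diagonal, and the shift \<open>\<sigma>\<^sub>S\<close> splits into weighted
  shifts of the coordinates.

  The conjugacy \<open>H\<close> therefore sends a sequence \<open>y\<close> to the family of its coordinate sequences
  \<open>n \<mapsto> c\<^sub>n\<^sub>,\<^sub>x(y\<^sub>n)\<close>, and its inverse is the synthesis map \<open>t \<mapsto> (\<Sum>\<^sub>x t\<^sub>x(n) e\<^sub>n(x))\<^sub>n\<close>.  Synthesis is
  bounded because the \<open>e\<^sub>n(x)\<close> are unit vectors and there are finitely many of them.  Analysis is
  bounded because \<open>\<parallel>c\<^sub>n\<^sub>,\<^sub>x(v) e\<^sub>n(x)\<parallel> = \<bar>c\<^sub>n\<^sub>,\<^sub>x(v)\<bar>\<close> is the norm of a coordinate projection, and these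
  projections are bounded uniformly in \<open>n\<close>; this is the one place where that hypothesis enters.
  The argument for an arbitrary moving frame is \<open>shift_conjugate_if_moving_frame\<close>.

  A supremum of operator norms controls a map only once the map is known to be bounded, since
  \<^const>\<open>onorm\<close> says nothing about an unbounded map.  Hence \<open>linear_bounded_if_finite_span_scalar\<close>,
  the continuity of linear maps on a finite dimensional space, is needed before the hypotheses on
  \<open>S\<close> and on the projections yield estimates.
\<close>

section \<open>Linear maps on finite dimensional normed spaces\<close>

text \<open>Equivalence of the norm with the \<open>\<ell>\<^sub>1\<close> norm of the coordinates, by induction on the basis.  The
  bound for \<open>B\<close> makes coordinates of Cauchy sequences Cauchy, so \<open>span B\<close> is closed and a new basis
  vector \<open>u\<close> lies at a distance \<open>d > 0\<close> from it; \<open>d\<close> controls the coefficient of \<open>u\<close>, and after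
  subtracting that component the bound for \<open>B\<close> controls the others.\<close>

lemma real_basis_lower_bound:
  fixes B :: "'a::real_normed_vector set"
  assumes "finite B" "independent B"
  shows "\<exists>c>0. \<forall>a. c * (\<Sum>b\<in>B. \<bar>a b\<bar>) \<le> norm (\<Sum>b\<in>B. a b *\<^sub>R b)"
  using assms
proof (induction B rule: finite_induct)
  case empty
  show ?case by (intro exI[of _ 1]) simp
next
  case (insert u B)
  have indB: "independent B" and u: "u \<notin> span B"
    using insert.prems insert.hyps by (auto simp: independent_insert)
  obtain c where c: "c > 0" "\<And>a. c * (\<Sum>b\<in>B. \<bar>a b\<bar>) \<le> norm (\<Sum>b\<in>B. a b *\<^sub>R b)"
    using insert.IH[OF indB] by blast
  have "\<exists>d>0. \<forall>a. d \<le> norm (u - (\<Sum>b\<in>B. a b *\<^sub>R b))"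
  proof (rule ccontr)
    assume contra: "\<not> ?thesis"
    have "\<exists>a. norm (u - (\<Sum>b\<in>B. a b *\<^sub>R b)) < 1 / real (Suc k)" for k
    proof -
      have "1 / real (Suc k) > 0" by simp
      then show ?thesis using contra not_less by blast
    qed
    then obtain a where a: "\<And>k. norm (u - (\<Sum>b\<in>B. a k b *\<^sub>R b)) < 1 / real (Suc k)"
      by metis
    define s where "s k = (\<Sum>b\<in>B. a k b *\<^sub>R b)" for k
    have lim: "s \<longlonglongrightarrow> u"
    proof (rule LIM_zero_cancel)
      show "(\<lambda>k. s k - u) \<longlonglongrightarrow> 0"
      proof (rule LIMSEQ_norm_0)
        show "norm (s k - u) < 1 / real (Suc k)" for k
          using a[of k] by (simp add: s_def norm_minus_commute)
      qed
    qed
    have "Cauchy s" using lim by (rule LIMSEQ_imp_Cauchy)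
    have "Cauchy (\<lambda>k. a k b)" if "b \<in> B" for b
    proof (rule metric_CauchyI)
      fix e :: real assume "e > 0"
      then obtain M where M: "\<And>m n. m \<ge> M \<Longrightarrow> n \<ge> M \<Longrightarrow> dist (s m) (s n) < c * e"
        using metric_CauchyD[OF \<open>Cauchy s\<close>, of "c * e"] c(1) by auto
      show "\<exists>M. \<forall>m\<ge>M. \<forall>n\<ge>M. dist (a m b) (a n b) < e"
      proof (intro exI allI impI)
        fix m n assume mn: "M \<le> m" "M \<le> n"
        have "c * \<bar>a m b - a n b\<bar> \<le> c * (\<Sum>b\<in>B. \<bar>a m b - a n b\<bar>)"
          using c(1) insert.hyps(1) that
          by (intro mult_left_mono member_le_sum) auto
        also have "\<dots> \<le> norm (\<Sum>b\<in>B. (a m b - a n b) *\<^sub>R b)" by (rule c(2))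
        also have "\<dots> = dist (s m) (s n)"
          by (simp add: s_def dist_norm scaleR_left_diff_distrib sum_subtractf)
        also have "\<dots> < c * e" using M mn by blast
        finally show "dist (a m b) (a n b) < e" using c(1) by (simp add: dist_real_def)
      qed
    qed
    then have l: "(\<lambda>k. a k b) \<longlonglongrightarrow> lim (\<lambda>k. a k b)" if "b \<in> B" for b
      using Cauchy_convergent convergent_LIMSEQ_iff that by blast
    define l where "l b = lim (\<lambda>k. a k b)" for b
    have "s \<longlonglongrightarrow> (\<Sum>b\<in>B. l b *\<^sub>R b)"
      unfolding s_def l_def by (intro tendsto_intros l)
    then have "u = (\<Sum>b\<in>B. l b *\<^sub>R b)" using lim LIMSEQ_unique by blast
    then have "u \<in> span B" by (auto intro!: span_sum span_scale intro: span_base)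
    then show False using u by contradiction
  qed
  then obtain d where d: "d > 0" "\<And>a. d \<le> norm (u - (\<Sum>b\<in>B. a b *\<^sub>R b))" by blast
  \<comment> \<open>\<open>1 / d\<close> bounds the coefficient of \<open>u\<close> in terms of \<open>norm t\<close>; the rest of \<open>t\<close> then has norm at
    most \<open>(1 + norm u / d) * norm t\<close>, and \<open>1 / c\<close> turns this into a bound on its coefficients.\<close>
  define K where "K = 1 / d + (1 + norm u / d) / c"
  have K: "K > 0" unfolding K_def using c(1) d(1) by (intro add_pos_nonneg) auto
  show ?case
  proof (intro exI[of _ "1 / K"] conjI allI)
    show "1 / K > 0" using K by simp
    fix a :: "'a \<Rightarrow> real"
    define s where "s = (\<Sum>b\<in>B. a b *\<^sub>R b)"
    define t where "t = a u *\<^sub>R u + s"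
    have au: "\<bar>a u\<bar> * d \<le> norm t"
    proof (cases "a u = 0")
      case False
      have "d \<le> norm (u - (\<Sum>b\<in>B. (- a b / a u) *\<^sub>R b))" by (rule d(2))
      also have "u - (\<Sum>b\<in>B. (- a b / a u) *\<^sub>R b) = (1 / a u) *\<^sub>R t"
        using False by (simp add: t_def s_def scaleR_sum_right scaleR_add_right sum_negf)
      finally show ?thesis using False by (simp add: field_simps)
    qed simp
    then have au': "\<bar>a u\<bar> \<le> norm t / d" using d(1) by (simp add: field_simps)
    have "c * (\<Sum>b\<in>B. \<bar>a b\<bar>) \<le> norm s" unfolding s_def by (rule c(2))
    also have "s = t - a u *\<^sub>R u" by (simp add: t_def)
    also have "norm \<dots> \<le> norm t + \<bar>a u\<bar> * norm u"
      by (metis norm_scaleR norm_triangle_ineq4)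
    also have "\<dots> \<le> norm t + norm t / d * norm u"
      using au' by (intro add_left_mono mult_right_mono) auto
    finally have "(\<Sum>b\<in>B. \<bar>a b\<bar>) \<le> (norm t + norm t / d * norm u) / c"
      using c(1) by (simp add: field_simps)
    then have "\<bar>a u\<bar> + (\<Sum>b\<in>B. \<bar>a b\<bar>) \<le> norm t / d + (norm t + norm t / d * norm u) / c"
      using au' by linarith
    also have "\<dots> = K * norm t" using c(1) d(1) by (simp add: K_def field_simps)
    finally show "1 / K * (\<Sum>b\<in>insert u B. \<bar>a b\<bar>) \<le> norm (\<Sum>b\<in>insert u B. a b *\<^sub>R b)"
      using K insert.hyps by (simp add: t_def s_def field_simps)
  qed
qed

lemma linear_bounded_if_finite_span:
  fixes f :: "'a::real_normed_vector \<Rightarrow> 'b::real_normed_vector" and B :: "'a set"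
  assumes "finite B" "span B = UNIV" "linear f"
  shows "bounded_linear f"
proof -
  interpret f: linear f by fact
  obtain B' where B': "B' \<subseteq> B" "independent B'" "B \<subseteq> span B'"
    using maximal_independent_subset[of B] by blast
  have fin: "finite B'" using B'(1) assms(1) finite_subset by blast
  have span: "span B' = UNIV" 
    using span_mono[OF B'(3)] assms(2) by (auto simp: span_span)
  obtain c where c: "c > 0" "\<And>a. c * (\<Sum>b\<in>B'. \<bar>a b\<bar>) \<le> norm (\<Sum>b\<in>B'. a b *\<^sub>R b)"
    using real_basis_lower_bound[OF fin B'(2)] by blast
  define M where "M = (\<Sum>b\<in>B'. norm (f b))"
  have "norm (f v) \<le> norm v * (M / c)" for v
  proof -
    have "v \<in> range (\<lambda>u. \<Sum>b\<in>B'. u b *\<^sub>R b)"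
      using span_finite[OF fin] span by simp
    then obtain a where a: "v = (\<Sum>b\<in>B'. a b *\<^sub>R b)" by blast
    have "norm (f v) \<le> (\<Sum>b\<in>B'. \<bar>a b\<bar> * norm (f b))"
      by (simp add: a f.sum f.scale sum_norm_le)
    also have "\<dots> \<le> (\<Sum>b\<in>B'. \<bar>a b\<bar> * M)"
      unfolding M_def by (intro sum_mono mult_left_mono member_le_sum fin) auto
    also have "\<dots> = (\<Sum>b\<in>B'. \<bar>a b\<bar>) * M" by (simp add: sum_distrib_right)
    also have "\<dots> \<le> norm v / c * M"
      using c(2)[of a] c(1) by (intro mult_right_mono) (auto simp: a M_def field_simps sum_nonneg)
    finally show ?thesis by simp
  qed
  then show ?thesis by (intro bounded_linear_intro[where K = "M / c"] f.add f.scale)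
qed

text \<open>Reduction to real scalars: a finite set spanning over \<open>\<bbbK>\<close> spans over \<open>\<real>\<close> once its multiples by the
  imaginary unit \<open>j\<close> are adjoined.\<close>

lemma (in normed_vector_space) linear_bounded_if_finite_span_scalar:
  fixes f :: "'x \<Rightarrow> 'b::real_normed_vector"
  assumes "finite B" "local.span B = UNIV" "Real_Vector_Spaces.linear f"
  shows "bounded_linear f"
proof -
  have sum_eq: "\<exists>a. v = (\<Sum>b\<in>B. sc (a b) b)" for v
    using span_finite[OF assms(1)] assms(2) by auto
  from real_or_complex[where 'a='k] show ?thesis
  proof
    assume re: "\<forall>z::'k. \<exists>a. z = a *\<^sub>R 1"
    have "v \<in> Real_Vector_Spaces.span B" for v
    proof -
      obtain a where a: "v = (\<Sum>b\<in>B. sc (a b) b)" using sum_eq by blast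
      obtain r where "\<And>b. a b = of_real (r b)"
        using choice[of "\<lambda>b r. a b = of_real r"] re unfolding of_real_def by blast
      then have "v = (\<Sum>b\<in>B. r b *\<^sub>R b)" by (simp add: a scale_of_real)
      then show ?thesis
        by (simp add: real_vector.span_base real_vector.span_scale real_vector.span_sum)
    qed
    then show ?thesis using linear_bounded_if_finite_span[OF assms(1) _ assms(3)] by blast
  next
    assume "\<exists>j::'k. j * j = - 1 \<and> (\<forall>z. \<exists>a b. z = a *\<^sub>R 1 + b *\<^sub>R j)"
    then obtain j :: 'k where j: "\<And>z. \<exists>a b. z = a *\<^sub>R 1 + b *\<^sub>R j" by blast
    let ?B = "B \<union> sc j ` B"
    have "v \<in> Real_Vector_Spaces.span ?B" for v
    proof -
      obtain a where a: "v = (\<Sum>b\<in>B. sc (a b) b)" using sum_eq by blast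
      have "\<forall>b. \<exists>q. a b = fst q *\<^sub>R 1 + snd q *\<^sub>R j" using j by auto
      then obtain q where q: "\<And>b. a b = fst (q b) *\<^sub>R 1 + snd (q b) *\<^sub>R j"
        using choice[of "\<lambda>b q. a b = fst q *\<^sub>R 1 + snd q *\<^sub>R j"] by blast
      define r s where "r b = fst (q b)" and "s b = snd (q b)" for b
      from q have rs: "a b = of_real (r b) + of_real (s b) * j" for b
        by (simp add: scaleR_conv_of_real r_def s_def)
      have "v = (\<Sum>b\<in>B. r b *\<^sub>R b + s b *\<^sub>R sc j b)"
        by (simp add: a rs scale_left_distrib scale_of_real flip: scale_scale)
      also have "\<dots> \<in> Real_Vector_Spaces.span ?B"
        by (intro real_vector.span_sum real_vector.span_add real_vector.span_scale
            real_vector.span_base) auto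
      finally show ?thesis .
    qed
    then show ?thesis using linear_bounded_if_finite_span[of ?B f] assms(1,3) by blast
  qed
qed

section \<open>Domination in sequence spaces\<close>

text \<open>A crude substitute for convexity and subadditivity: bounding the sum by its number of terms times
  the largest one gives a single estimate valid for every exponent \<open>q > 0\<close>.  It is used with both
  \<open>q = p\<close> and \<open>q = 1 / p\<close>.\<close>

lemma powr_sum_le:
  fixes a :: "'i \<Rightarrow> real"
  assumes "finite I" "\<And>i. i \<in> I \<Longrightarrow> 0 \<le> a i" "0 < q"
  shows "(\<Sum>i\<in>I. a i) powr q \<le> real (card I) powr q * (\<Sum>i\<in>I. a i powr q)"
proof (cases "I = {}")
  case False
  define m where "m = Max (a ` I)"
  have m: "\<And>i. i \<in> I \<Longrightarrow> a i \<le> m" "m \<in> a ` I"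
    unfolding m_def using assms(1) False by (auto intro: Max_in)
  then obtain k where k: "k \<in> I" "m = a k" by blast
  have "(\<Sum>i\<in>I. a i) powr q \<le> (real (card I) * m) powr q"
    using m(1) assms by (intro powr_mono2 sum_bounded_above sum_nonneg) auto
  also have "\<dots> = real (card I) powr q * a k powr q"
    using assms(2)[OF k(1)] k(2) by (simp add: powr_mult)
  also have "\<dots> \<le> real (card I) powr q * (\<Sum>i\<in>I. a i powr q)"
    using assms(1) k(1) by (intro mult_left_mono member_le_sum) auto
  finally show ?thesis .
qed simp

lemma has_sum_finite_sum:
  fixes f :: "'i \<Rightarrow> 'n \<Rightarrow> 'a::topological_comm_monoid_add"
  assumes "finite I" "\<And>i. i \<in> I \<Longrightarrow> (f i has_sum s i) A"
  shows "((\<lambda>n. \<Sum>i\<in>I. f i n) has_sum (\<Sum>i\<in>I. s i)) A"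
  using assms by (induction I rule: finite_induct) (auto intro!: has_sum_add has_sum_0)

text \<open>All boundedness statements about sequence spaces reduce to this pointwise comparison with finitely
  many \<open>p\<close>-summable sequences: with \<open>N = card I\<close>, raising to the power \<open>p\<close> costs a factor
  \<open>(C * N) powr p\<close>, and pulling the outer root through the sum costs \<open>N powr (1 / p)\<close>.\<close>

lemma lp_dominated:
  fixes y :: "'n \<Rightarrow> 'a::real_normed_vector" and z :: "'i \<Rightarrow> 'n \<Rightarrow> 'b::real_normed_vector"
  assumes fin: "finite I" and p: "0 < p" and C: "0 \<le> C"
    and z: "\<And>i. i \<in> I \<Longrightarrow> (\<lambda>n. norm (z i n) powr p) summable_on UNIV"
    and le: "\<And>n. norm (y n) \<le> C * (\<Sum>i\<in>I. norm (z i n))"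
  shows "(\<lambda>n. norm (y n) powr p) summable_on UNIV"
    and "(\<Sum>\<^sub>\<infinity>n. norm (y n) powr p) powr (1 / p) \<le>
      C * real (card I) * real (card I) powr (1 / p) *
      (\<Sum>i\<in>I. (\<Sum>\<^sub>\<infinity>n. norm (z i n) powr p) powr (1 / p))"
proof -
  let ?N = "real (card I)"
  let ?R = "\<lambda>i. \<Sum>\<^sub>\<infinity>n. norm (z i n) powr p"
  let ?K = "(C * ?N) powr p"
  have pw: "norm (y n) powr p \<le> ?K * (\<Sum>i\<in>I. norm (z i n) powr p)" for n
  proof -
    have "norm (y n) powr p \<le> (C * (\<Sum>i\<in>I. norm (z i n))) powr p"
      using le p by (intro powr_mono2) auto
    also have "\<dots> = C powr p * (\<Sum>i\<in>I. norm (z i n)) powr p"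
      using C by (simp add: powr_mult sum_nonneg)
    also have "\<dots> \<le> C powr p * (?N powr p * (\<Sum>i\<in>I. norm (z i n) powr p))"
      by (intro mult_left_mono powr_sum_le fin p) auto
    also have "\<dots> = ?K * (\<Sum>i\<in>I. norm (z i n) powr p)"
      using C by (simp add: powr_mult)
    finally show ?thesis .
  qed
  have hsz: "((\<lambda>n. \<Sum>i\<in>I. norm (z i n) powr p) has_sum (\<Sum>i\<in>I. ?R i)) UNIV"
    using z by (intro has_sum_finite_sum fin) auto
  then have sumz: "(\<lambda>n. \<Sum>i\<in>I. norm (z i n) powr p) summable_on UNIV"
    by (rule has_sum_imp_summable)
  have sumK: "(\<lambda>n. ?K * (\<Sum>i\<in>I. norm (z i n) powr p)) summable_on UNIV"
    by (intro summable_on_cmult_right sumz)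
  show sumy: "(\<lambda>n. norm (y n) powr p) summable_on UNIV"
    by (rule summable_on_comparison_test[OF sumK]) (use pw in auto)
  have R: "0 \<le> ?R i" for i by (intro infsum_nonneg) auto
  have "(\<Sum>\<^sub>\<infinity>n. norm (y n) powr p) \<le> (\<Sum>\<^sub>\<infinity>n. ?K * (\<Sum>i\<in>I. norm (z i n) powr p))"
    by (intro infsum_mono sumy sumK pw)
  also have "\<dots> = ?K * (\<Sum>\<^sub>\<infinity>n. \<Sum>i\<in>I. norm (z i n) powr p)"
    by (intro infsum_cmult_right sumz)
  also have "\<dots> = ?K * (\<Sum>i\<in>I. ?R i)"
    using hsz by (simp add: infsumI)
  finally have "(\<Sum>\<^sub>\<infinity>n. norm (y n) powr p) powr (1 / p) \<le> (?K * (\<Sum>i\<in>I. ?R i)) powr (1 / p)"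
    using p by (intro powr_mono2) (auto intro: infsum_nonneg)
  also have "\<dots> = C * ?N * (\<Sum>i\<in>I. ?R i) powr (1 / p)"
    using R C p by (simp add: powr_mult powr_powr sum_nonneg)
  also have "\<dots> \<le> C * ?N * (?N powr (1 / p) * (\<Sum>i\<in>I. ?R i powr (1 / p)))"
    using R C p by (intro mult_left_mono powr_sum_le fin) auto
  finally show "(\<Sum>\<^sub>\<infinity>n. norm (y n) powr p) powr (1 / p) \<le>
      C * ?N * ?N powr (1 / p) * (\<Sum>i\<in>I. ?R i powr (1 / p))"
    by (simp add: mult.assoc)
qed

lemma lp_space_dominated_sum:
  fixes I :: "'i set" and sc :: "'k \<Rightarrow> 'a::real_normed_vector \<Rightarrow> 'a"
    and sc' :: "'k \<Rightarrow> 'b::real_normed_vector \<Rightarrow> 'b"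
  assumes "finite I" "1 \<le> p" "0 \<le> C"
  obtains K where
    "\<And>y z. (\<And>i. i \<in> I \<Longrightarrow> z i \<in> pts (lp_space p sc)) \<Longrightarrow>
      (\<And>n. norm (y n) \<le> C * (\<Sum>i\<in>I. norm (z i n))) \<Longrightarrow>
      y \<in> pts (lp_space p sc') \<and>
      nrm (lp_space p sc') y \<le> K * (\<Sum>i\<in>I. nrm (lp_space p sc) (z i))"
proof
  fix y :: "int \<Rightarrow> 'b" and z :: "'i \<Rightarrow> int \<Rightarrow> 'a"
  assume *: "\<And>i. i \<in> I \<Longrightarrow> z i \<in> pts (lp_space p sc)"
    "\<And>n. norm (y n) \<le> C * (\<Sum>i\<in>I. norm (z i n))"
  show "y \<in> pts (lp_space p sc') \<and>
      nrm (lp_space p sc') y \<le>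
      (C * real (card I) * real (card I) powr (1 / p)) * (\<Sum>i\<in>I. nrm (lp_space p sc) (z i))"
    using lp_dominated[of I p C z y] * assms by (simp add: lp_space_def)
qed

lemma lp_space_dominated:
  assumes "1 \<le> p" "0 \<le> C" "z \<in> pts (lp_space p sc)" "\<And>n. norm (y n) \<le> C * norm (z n)"
  shows "y \<in> pts (lp_space p sc')" "nrm (lp_space p sc') y \<le> C * nrm (lp_space p sc) z"
  using lp_dominated[of "{()}" p C "\<lambda>_. z" y] assms by (auto simp: lp_space_def)

text \<open>Translation of the index is an isometry because it only permutes the terms of the norm series.\<close>

lemma lp_space_translate:
  "(\<lambda>n. y (n + k)) \<in> pts (lp_space p sc) \<longleftrightarrow> y \<in> pts (lp_space p sc)"
  "nrm (lp_space p sc) (\<lambda>n. y (n + k)) = nrm (lp_space p sc) y"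
proof -
  have bij: "bij_betw (\<lambda>n::int. n + k) UNIV UNIV"
    by (rule bij_betwI[where g = "\<lambda>n. n - k"]) auto
  show "(\<lambda>n. y (n + k)) \<in> pts (lp_space p sc) \<longleftrightarrow> y \<in> pts (lp_space p sc)"
    using summable_on_reindex_bij_betw[OF bij, of "\<lambda>n. norm (y n) powr p"]
    by (simp add: lp_space_def)
  show "nrm (lp_space p sc) (\<lambda>n. y (n + k)) = nrm (lp_space p sc) y"
    using infsum_reindex_bij_betw[OF bij, of "\<lambda>n. norm (y n) powr p"]
    by (simp add: lp_space_def)
qed

lemma lp_space_nrm_nonneg: "0 \<le> nrm (lp_space p sc) y"
  by (simp add: lp_space_def)

lemma lp_space_add_closed:
  fixes sc :: "'k \<Rightarrow> 'a::real_normed_vector \<Rightarrow> 'a"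
  assumes "1 \<le> p" "y \<in> pts (lp_space p sc)" "z \<in> pts (lp_space p sc)"
  shows "add (lp_space p sc) y z \<in> pts (lp_space p sc)"
proof -
  have "(\<lambda>n. norm (y n + z n) powr p) summable_on UNIV"
    by (rule lp_dominated(1)[of "{True, False}" p 1 "\<lambda>b. if b then y else z"])
      (use assms in \<open>auto simp: lp_space_def norm_triangle_ineq\<close>)
  then show ?thesis by (simp add: lp_space_def)
qed

lemma (in normed_vector_space) lp_space_smul_closed:
  assumes "1 \<le> p" "y \<in> pts (lp_space p sc)"
  shows "smul (lp_space p sc) a y \<in> pts (lp_space p sc)"
  by (rule lp_space_dominated[of p "norm a" y sc])
    (use assms in \<open>auto simp: norm_scale lp_space_def\<close>)

section \<open>Bounded operators between explicit spaces\<close>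

lemma bounded_operatorD:
  assumes "bounded_operator Y Z T"
  shows "u \<in> pts Y \<Longrightarrow> T u \<in> pts Z"
    and "u \<in> pts Y \<Longrightarrow> v \<in> pts Y \<Longrightarrow> T (add Y u v) = add Z (T u) (T v)"
    and "u \<in> pts Y \<Longrightarrow> T (smul Y a u) = smul Z a (T u)"
    and "\<exists>C. \<forall>u\<in>pts Y. nrm Z (T u) \<le> C * nrm Y u"
  using assms unfolding bounded_operator_def Pi_iff by blast+

lemma bounded_operatorI:
  assumes "\<And>u. u \<in> pts Y \<Longrightarrow> T u \<in> pts Z"
    and "\<And>u v. u \<in> pts Y \<Longrightarrow> v \<in> pts Y \<Longrightarrow> T (add Y u v) = add Z (T u) (T v)"
    and "\<And>a u. u \<in> pts Y \<Longrightarrow> T (smul Y a u) = smul Z a (T u)"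
    and "\<And>u. u \<in> pts Y \<Longrightarrow> nrm Z (T u) \<le> C * nrm Y u"
  shows "bounded_operator Y Z T"
  using assms unfolding bounded_operator_def Pi_iff by blast

text \<open>The common form of the two shifts (\<open>k = 1\<close>) and of the passage to one coordinate (\<open>k = 0\<close>).\<close>

lemma bounded_operator_lp_fibrewise:
  assumes "1 \<le> p" "0 \<le> C"
    and "\<And>n u v. L n (u + v) = L n u + L n v"
    and "\<And>n a u. L n (sc a u) = sc' a (L n u)"
    and "\<And>n u. norm (L n u) \<le> C * norm u"
  shows "bounded_operator (lp_space p sc) (lp_space p sc') (\<lambda>y n. L n (y (n + k)))"
proof -
  have *: "(\<lambda>n. L n (y (n + k))) \<in> pts (lp_space p sc')"
      "nrm (lp_space p sc') (\<lambda>n. L n (y (n + k))) \<le> C * nrm (lp_space p sc) y"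
    if "y \<in> pts (lp_space p sc)" for y
    using lp_space_dominated[OF assms(1,2), of "\<lambda>n. y (n + k)" sc "\<lambda>n. L n (y (n + k))" sc']
      that assms(5) by (auto simp: lp_space_translate)
  show ?thesis
    by (rule bounded_operatorI[where C = C]) (simp_all add: *, simp_all add: lp_space_def assms(3,4))
qed

lemma product_space_component:
  "f \<in> pts (product_space I Y) \<Longrightarrow> i \<in> I \<Longrightarrow> f i \<in> pts Y"
  by (auto simp: product_space_def)

lemma bounded_operator_into_product:
  assumes "finite I" and T: "\<And>i. i \<in> I \<Longrightarrow> bounded_operator Y Z (T i)"
  shows "bounded_operator Y (product_space I Z) (\<lambda>y. \<lambda>i\<in>I. T i y)"
proof -
  have "\<forall>i\<in>I. \<exists>C. \<forall>u\<in>pts Y. nrm Z (T i u) \<le> C * nrm Y u"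
    using bounded_operatorD(4)[OF T] by blast
  from bchoice[OF this] obtain C
    where C: "\<And>i u. i \<in> I \<Longrightarrow> u \<in> pts Y \<Longrightarrow> nrm Z (T i u) \<le> C i * nrm Y u"
    by blast
  show ?thesis
  proof (rule bounded_operatorI)
    fix u assume u: "u \<in> pts Y"
    show "(\<lambda>i\<in>I. T i u) \<in> pts (product_space I Z)"
      using bounded_operatorD(1)[OF T u] by (simp add: product_space_def)
    show "nrm (product_space I Z) (\<lambda>i\<in>I. T i u) \<le> (\<Sum>i\<in>I. C i) * nrm Y u"
      using C[OF _ u] by (simp add: product_space_def sum_distrib_right sum_mono)
  qed (simp_all add: product_space_def bounded_operatorD(2,3)[OF T] cong: restrict_cong)
qed

lemma bounded_operator_product:
  assumes "finite I" and T: "\<And>i. i \<in> I \<Longrightarrow> bounded_operator Y Z (T i)"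
    and nonneg: "\<And>u. u \<in> pts Y \<Longrightarrow> 0 \<le> nrm Y u"
  shows "bounded_operator (product_space I Y) (product_space I Z) (product_operator I T)"
proof -
  have "bounded_operator (product_space I Y) Z (\<lambda>f. T i (f i))" if i: "i \<in> I" for i
  proof -
    obtain C where C: "\<And>u. u \<in> pts Y \<Longrightarrow> nrm Z (T i u) \<le> C * nrm Y u"
      using bounded_operatorD(4)[OF T[OF i]] by blast
    note mem = product_space_component[of _ I Y]
    show ?thesis
    proof (rule bounded_operatorI)
      fix f assume f: "f \<in> pts (product_space I Y)"
      show "T i (f i) \<in> pts Z" using bounded_operatorD(1)[OF T[OF i] mem[OF f i]] .
      have "nrm Z (T i (f i)) \<le> C * nrm Y (f i)" by (rule C[OF mem[OF f i]])
      also have "\<dots> \<le> \<bar>C\<bar> * nrm Y (f i)"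
        using nonneg[OF mem[OF f i]] by (intro mult_right_mono) auto
      also have "\<dots> \<le> \<bar>C\<bar> * (\<Sum>j\<in>I. nrm Y (f j))"
        using nonneg[OF mem[OF f]] i assms(1) by (intro mult_left_mono member_le_sum) auto
      finally show "nrm Z (T i (f i)) \<le> \<bar>C\<bar> * nrm (product_space I Y) f"
        by (simp add: product_space_def)
    next
      fix f g assume "f \<in> pts (product_space I Y)" "g \<in> pts (product_space I Y)"
      then show "T i (add (product_space I Y) f g i) = add Z (T i (f i)) (T i (g i))"
        using i bounded_operatorD(2)[OF T[OF i] mem mem] by (simp add: product_space_def)
    next
      fix a f assume "f \<in> pts (product_space I Y)"
      then show "T i (smul (product_space I Y) a f i) = smul Z a (T i (f i))"
        using i bounded_operatorD(3)[OF T[OF i] mem] by (simp add: product_space_def)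
    qed
  qed
  then show ?thesis
    unfolding product_operator_def[abs_def] by (intro bounded_operator_into_product assms(1))
qed

text \<open>Used for \<^const>\<open>inv_into\<close>, which agrees with the explicit inverse only on the carrier; closure of
  the carrier makes this enough for linearity.\<close>

lemma bounded_operator_cong:
  assumes T: "bounded_operator Y Z T" and eq: "\<And>u. u \<in> pts Y \<Longrightarrow> T' u = T u"
    and "\<And>u v. u \<in> pts Y \<Longrightarrow> v \<in> pts Y \<Longrightarrow> add Y u v \<in> pts Y"
    and "\<And>a u. u \<in> pts Y \<Longrightarrow> smul Y a u \<in> pts Y"
  shows "bounded_operator Y Z T'"
proof -
  obtain C where "\<And>u. u \<in> pts Y \<Longrightarrow> nrm Z (T u) \<le> C * nrm Y u"
    using bounded_operatorD(4)[OF T] by blast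
  then show ?thesis
    by (intro bounded_operatorI[where C = C])
      (simp_all add: assms(2-4) bounded_operatorD(1-3)[OF T])
qed

lemma normed_vector_space_field: "normed_vector_space ((*) :: 'k::real_or_complex \<Rightarrow> 'k \<Rightarrow> 'k)"
  by unfold_locales (auto simp: algebra_simps norm_mult scaleR_conv_of_real)

section \<open>Conjugacy by a moving frame\<close>

lemma (in normed_vector_space) bounded_operator_synthesis:
  assumes "finite I" "1 \<le> p" and e: "\<And>n i. i \<in> I \<Longrightarrow> norm (e n i) = 1"
  shows "bounded_operator (product_space I (lp_space p ((*) :: 'k \<Rightarrow> 'k \<Rightarrow> 'k))) (lp_space p sc)
    (\<lambda>t n. \<Sum>i\<in>I. sc (t i n) (e n i))"
proof -
  let ?G = "\<lambda>(t :: 'a \<Rightarrow> int \<Rightarrow> 'k) n. \<Sum>i\<in>I. sc (t i n) (e n i)"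
  let ?L = "lp_space p ((*) :: 'k \<Rightarrow> 'k \<Rightarrow> 'k)"
  obtain K where K: "\<And>(y :: int \<Rightarrow> 'x) z. (\<And>i. i \<in> I \<Longrightarrow> z i \<in> pts ?L) \<Longrightarrow>
      (\<And>n. norm (y n) \<le> 1 * (\<Sum>i\<in>I. norm (z i n))) \<Longrightarrow>
      y \<in> pts (lp_space p sc) \<and> nrm (lp_space p sc) y \<le> K * (\<Sum>i\<in>I. nrm ?L (z i))"
    using lp_space_dominated_sum[OF assms(1,2) zero_le_one] by metis
  have le: "norm (?G t n) \<le> 1 * (\<Sum>i\<in>I. norm (t i n))" for t n
    by (simp, intro sum_norm_le) (simp add: norm_scale e)
  have G: "?G t \<in> pts (lp_space p sc)"
      "nrm (lp_space p sc) (?G t) \<le> K * nrm (product_space I ?L) t"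
    if "t \<in> pts (product_space I ?L)" for t
  proof -
    have "t i \<in> pts ?L" if "i \<in> I" for i
      using \<open>t \<in> pts (product_space I ?L)\<close> that by (rule product_space_component)
    then have "?G t \<in> pts (lp_space p sc) \<and>
        nrm (lp_space p sc) (?G t) \<le> K * (\<Sum>i\<in>I. nrm ?L (t i))"
    proof (rule K[of t])
      show "norm (?G t n) \<le> 1 * (\<Sum>i\<in>I. norm (t i n))" for n by (rule le)
    qed
    then show "?G t \<in> pts (lp_space p sc)"
      "nrm (lp_space p sc) (?G t) \<le> K * nrm (product_space I ?L) t"
      by (simp_all add: product_space_def)
  qed
  have "?G (add (product_space I ?L) s t) = add (lp_space p sc) (?G s) (?G t)" for s t
    by (simp add: product_space_def lp_space_def scale_left_distrib sum.distrib)
  moreover have "?G (smul (product_space I ?L) a t) = smul (lp_space p sc) a (?G t)" for a t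
    by (simp add: product_space_def lp_space_def scale_sum_right)
  ultimately show ?thesis
    using G by (intro bounded_operatorI[where C = K])
qed

text \<open>The frames \<open>e n\<close> diagonalise the cocycle \<open>S\<close>, and the conjugacy is passage to coordinates.  A
  uniform bound on the coordinate functionals \<open>c n i\<close> is what makes it bounded.  Linearity of these
  functionals follows from uniqueness of coordinates, and boundedness of the weights from that of
  \<open>S\<close>, because \<open>w i n\<close> and \<open>S n (e n i)\<close> have the same norm.\<close>

lemma (in normed_vector_space) shift_conjugate_if_moving_frame:
  fixes e :: "int \<Rightarrow> 'i \<Rightarrow> 'x" and c :: "int \<Rightarrow> 'i \<Rightarrow> 'x \<Rightarrow> 'k" and w :: "'i \<Rightarrow> int \<Rightarrow> 'k"
  assumes fin: "finite I" and p: "1 \<le> p"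
    and unit: "\<And>n i. i \<in> I \<Longrightarrow> norm (e n i) = 1"
    and expand: "\<And>n v. (\<Sum>i\<in>I. sc (c n i v) (e n i)) = v"
    and unique: "\<And>n i a. i \<in> I \<Longrightarrow> c n i (\<Sum>j\<in>I. sc (a j) (e n j)) = a i"
    and coord: "0 \<le> M" "\<And>n i v. i \<in> I \<Longrightarrow> norm (c n i v) \<le> M * norm v"
    and lin: "\<And>n. Vector_Spaces.linear sc sc (S n)"
    and bounded: "0 \<le> C" "\<And>n v. norm (S n v) \<le> C * norm v"
    and move: "\<And>n i. i \<in> I \<Longrightarrow> S n (e n i) = sc (w i n) (e (n - 1) i)"
  shows "conjugate_operators (lp_space p sc) (shift_operator S)
    (product_space I (lp_space p ((*) :: 'k \<Rightarrow> 'k \<Rightarrow> 'k)))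
    (product_operator I (\<lambda>i. weighted_backward_shift (w i)))"
proof -
  let ?L = "lp_space p ((*) :: 'k \<Rightarrow> 'k \<Rightarrow> 'k)"
  let ?X = "lp_space p sc" and ?P = "product_space I ?L"
  interpret K: normed_vector_space "(*) :: 'k \<Rightarrow> 'k \<Rightarrow> 'k" by (rule normed_vector_space_field)
  have c_add: "c n i (u + v) = c n i u + c n i v" if "i \<in> I" for n i u v
  proof -
    have "u + v = (\<Sum>j\<in>I. sc (c n j u + c n j v) (e n j))"
      by (simp add: scale_left_distrib sum.distrib expand)
    then show ?thesis using unique[OF that, of n "\<lambda>j. c n j u + c n j v"] by simp
  qed
  have c_scale: "c n i (sc a v) = a * c n i v" if "i \<in> I" for n i a v
  proof -
    have "sc a v = sc a (\<Sum>j\<in>I. sc (c n j v) (e n j))" by (simp add: expand)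
    also have "\<dots> = (\<Sum>j\<in>I. sc (a * c n j v) (e n j))" by (simp add: scale_sum_right)
    finally show ?thesis using unique[OF that, of n "\<lambda>j. a * c n j v"] by simp
  qed
  have S_add: "S n (u + v) = S n u + S n v" and S_scale: "S n (sc a u) = sc a (S n u)" for n a u v
    using lin[of n] by (simp_all add: Vector_Spaces.linear_iff)
  have S_sum: "S n (sum f I) = (\<Sum>i\<in>I. S n (f i))" for n and f :: "'i \<Rightarrow> 'x"
    using lin[of n] unfolding linear_iff_module_hom by (rule module_hom.sum)
  have c_S: "c (n - 1) i (S n v) = w i n * c n i v" if "i \<in> I" for n i v
  proof -
    have "S n v = S n (\<Sum>j\<in>I. sc (c n j v) (e n j))" by (simp add: expand)
    also have "\<dots> = (\<Sum>j\<in>I. sc (w j n * c n j v) (e (n - 1) j))"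
      by (simp add: S_sum S_scale move mult.commute)
    finally show ?thesis using unique[OF that, of "n - 1" "\<lambda>j. w j n * c n j v"] by simp
  qed
  have w_le: "norm (w i n) \<le> C" if "i \<in> I" for i n
    using bounded(2)[of n "e n i"] that by (simp add: move unit norm_scale)

  have X_shift: "bounded_operator ?X ?X (shift_operator S)"
    unfolding shift_operator_def
    using bounded_operator_lp_fibrewise[OF p bounded(1), of "\<lambda>n. S (n + 1)" sc sc 1]
      S_add S_scale bounded(2) by simp
  have "bounded_operator ?L ?L (weighted_backward_shift (w i))" if "i \<in> I" for i
    unfolding weighted_backward_shift_def
    by (rule bounded_operator_lp_fibrewise
        [OF p bounded(1), where L = "\<lambda>n t. w i (n + 1) * t" and k = 1])
      (use w_le[OF that] in \<open>auto simp: distrib_left mult.left_commute norm_mult mult_right_mono\<close>)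
  then have P_shift: "bounded_operator ?P ?P (product_operator I (\<lambda>i. weighted_backward_shift (w i)))"
    by (intro bounded_operator_product fin lp_space_nrm_nonneg)

  define H where "H y = (\<lambda>i\<in>I. \<lambda>n. c n i (y n))" for y
  define G where "G t = (\<lambda>n. \<Sum>i\<in>I. sc (t i n) (e n i))" for t
  have "bounded_operator ?X ?L (\<lambda>y n. c n i (y n))" if "i \<in> I" for i
    using bounded_operator_lp_fibrewise[OF p coord(1), of "\<lambda>n. c n i" sc "(*)" 0]
      c_add c_scale coord(2) that by simp
  then have H: "bounded_operator ?X ?P H"
    unfolding H_def[abs_def] by (intro bounded_operator_into_product fin)
  have G: "bounded_operator ?P ?X G"
    unfolding G_def[abs_def] using fin p unit by (rule bounded_operator_synthesis)
  have GH: "G (H y) = y" for y by (simp add: G_def H_def expand)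
  have HG: "H (G t) = t" if "t \<in> pts ?P" for t
  proof
    fix i
    show "H (G t) i = t i"
    proof (cases "i \<in> I")
      case True
      then show ?thesis
        using unique[OF True, of _ "\<lambda>j. t j _"] by (simp add: H_def G_def)
    next
      case False
      then show ?thesis
        using that by (simp add: H_def product_space_def PiE_iff extensional_def)
    qed
  qed
  have bij: "bij_betw H (pts ?X) (pts ?P)"
    using H G GH HG by (intro bij_betwI[where g = G]) (auto simp: bounded_operatorD(1))
  have "bounded_operator ?P ?X (inv_into (pts ?X) H)"
  proof (rule bounded_operator_cong[OF G])
    fix t assume t: "t \<in> pts ?P"
    show "inv_into (pts ?X) H t = G t"
      using bij G HG[OF t] t
      by (intro inv_into_f_eq) (auto simp: bij_betw_def bounded_operatorD(1))
  next
    fix s t assume "s \<in> pts ?P" "t \<in> pts ?P"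
    then show "add ?P s t \<in> pts ?P"
      by (simp add: product_space_def PiE_iff lp_space_add_closed[OF p])
  next
    fix a t assume "t \<in> pts ?P"
    then show "smul ?P a t \<in> pts ?P"
      by (simp add: product_space_def PiE_iff K.lp_space_smul_closed[OF p])
  qed
  moreover have "H (shift_operator S y) =
      product_operator I (\<lambda>i. weighted_backward_shift (w i)) (H y)" for y
  proof
    fix i
    show "H (shift_operator S y) i =
        product_operator I (\<lambda>i. weighted_backward_shift (w i)) (H y) i"
      using c_S[of i "n + 1" for n]
      by (cases "i \<in> I") (auto simp: H_def product_operator_def shift_operator_def
          weighted_backward_shift_def)
  qed
  ultimately show ?thesis
    unfolding conjugate_operators_def using X_shift P_shift H bij by blast
qed

section \<open>Orbits of the cocycle\<close>

text \<open>The map \<open>A\<^sub>n\<close> that carries \<open>x\<close> at time \<open>0\<close> to the point at time \<open>n\<close> of the orbit through \<open>x\<close>; the time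
  runs backwards along \<open>S\<close>, in the sense of \<open>orbit_map_step\<close> below.\<close>

definition orbit_map :: "(int \<Rightarrow> 'x \<Rightarrow> 'x) \<Rightarrow> int \<Rightarrow> 'x \<Rightarrow> 'x"
  where "orbit_map S n =
    (if n \<ge> 0 then inv (comp_between S 1 n) else comp_between S (n + 1) 0)"

lemma comp_between_empty: "n > m \<Longrightarrow> comp_between S n m = id"
  by (simp add: comp_between_def)

lemma comp_between_rec_left: "n \<le> m \<Longrightarrow> comp_between S n m = S n \<circ> comp_between S (n + 1) m"
  by (simp add: comp_between_def upto_rec1)

lemma foldr_comp_append: "foldr (\<circ>) (fs @ [g]) id = foldr (\<circ>) fs id \<circ> g"
  by (induction fs) (simp_all add: comp_assoc)

lemma comp_between_rec_right: "n \<le> m \<Longrightarrow> comp_between S n m = comp_between S n (m - 1) \<circ> S m"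
  by (simp only: comp_between_def upto_rec2 map_append list.map foldr_comp_append)

text \<open>At \<open>n = 0\<close> both branches of the definition are the identity.\<close>

lemma orbit_map_nonpos: "n \<le> 0 \<Longrightarrow> orbit_map S n = comp_between S (n + 1) 0"
  by (cases "n = 0") (simp_all add: orbit_map_def comp_between_empty inv_id)

lemma orbit_vector_eq: "orbit_vector S n x = orbit_map S n x /\<^sub>R norm (orbit_map S n x)"
  by (simp add: orbit_vector_def orbit_map_def)

text \<open>For \<open>n > 0\<close> both \<open>n - 1\<close> and \<open>n\<close> fall under the pull-back branch of \<^const>\<open>orbit_map\<close>, and for
  \<open>n \<le> 0\<close> both fall under the push-forward formula, which by \<open>orbit_map_nonpos\<close> extends to \<open>0\<close>.\<close>

lemma weight_eq: "weight S x n = norm (orbit_map S (n - 1) x) / norm (orbit_map S n x)"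
  by (cases "n > 0") (simp_all add: weight_def orbit_map_nonpos, simp add: orbit_map_def)

context vector_space
begin

lemma linear_bij_comp_between:
  assumes "\<And>n. Vector_Spaces.linear scale scale (S n)" "\<And>n. bij (S n)"
  shows "Vector_Spaces.linear scale scale (comp_between S n m) \<and> bij (comp_between S n m)"
proof -
  have "Vector_Spaces.linear scale scale (foldr (\<circ>) (map S ks) id) \<and>
      bij (foldr (\<circ>) (map S ks) id)" for ks
    using assms by (induction ks) (auto simp: Vector_Spaces.linear_iff bij_comp vector_space_axioms)
  then show ?thesis by (simp add: comp_between_def)
qed

lemma linear_bij_orbit_map:
  assumes "\<And>n. Vector_Spaces.linear scale scale (S n)" "\<And>n. bij (S n)"
  shows "Vector_Spaces.linear scale scale (orbit_map S n)" "bij (orbit_map S n)"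
  using linear_bij_comp_between[OF assms]
  by (auto simp: orbit_map_def linear_iff_module_hom bij_imp_bij_inv
      intro: bij_module_hom_imp_inv_module_hom)

end

lemma orbit_map_step:
  assumes "\<And>n. bij (S n)" "\<And>n m. bij (comp_between S n m)"
  shows "S n (orbit_map S n x) = orbit_map S (n - 1) x"
proof (cases "n > 0")
  case True
  have "inv (comp_between S 1 n) = inv (S n) \<circ> inv (comp_between S 1 (n - 1))"
    using True assms by (simp add: comp_between_rec_right[of 1 n] o_inv_distrib)
  then show ?thesis
    using True assms(1)[of n] by (simp add: orbit_map_def bij_is_surj surj_f_inv_f)
next
  case False
  then show ?thesis
    by (simp add: orbit_map_nonpos comp_between_rec_left[of n 0])
qed

text \<open>A spanning family with no more members than the dimension has no repetitions and no relations, so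
  spanning is all that has to be checked for \<open>e\<^sub>n(E)\<close> to be a basis indexed by \<open>E\<close>.\<close>

lemma (in finite_dimensional_vector_space) basis_if_spans_Basis_image:
  assumes "span (f ` Basis) = UNIV"
  shows "independent (f ` Basis)" "inj_on f Basis"
proof -
  have fin: "finite (f ` Basis)" using finite_Basis by simp
  have "dim UNIV \<le> card (f ` Basis)"
    using assms fin by (intro dim_le_card) auto
  moreover have "card (f ` Basis) \<le> card Basis" by (rule card_image_le[OF finite_Basis])
  ultimately have card: "card (f ` Basis) = card Basis" by simp
  then show "inj_on f Basis" by (rule eq_card_imp_inj_on[OF finite_Basis])
  show "independent (f ` Basis)"
    using assms fin card by (intro card_le_dim_spanning[of _ UNIV]) auto
qed

section \<open>Conjugacy of the shift to weighted backward shifts\<close>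

theorem theorem2p10:
  fixes sc :: "'k::real_or_complex \<Rightarrow> 'x::banach \<Rightarrow> 'x"
    and S :: "int \<Rightarrow> 'x \<Rightarrow> 'x"
    and E :: "'x set"
    and p :: real
  assumes "normed_vector_space sc"
    and "finite_dimensional_vector_space sc E"
    and "\<forall>n. Vector_Spaces.linear sc sc (S n) \<and> bij (S n)"
    and "\<exists>C\<^sub>0>0. \<forall>n. onorm (S n) < C\<^sub>0 \<and> onorm (inv (S n)) < C\<^sub>0"
    and "has_bounded_projections sc S E"
    and "1 \<le> p"
  shows "conjugate_operators
    (lp_space p sc) (shift_operator S)
    (product_space E (lp_space p ((*) :: 'k \<Rightarrow> 'k \<Rightarrow> 'k)))
    (product_operator E (\<lambda>x. weighted_backward_shift (\<lambda>n. of_real (weight S x n))))"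
proof -
  interpret V: normed_vector_space sc by fact
  interpret F: finite_dimensional_vector_space sc E by fact
  have S_lin: "\<And>n. Vector_Spaces.linear sc sc (S n)" and S_bij: "\<And>n. bij (S n)"
    using assms(3) by auto
  have real_linear: "Real_Vector_Spaces.linear f" if "Vector_Spaces.linear sc sc f" for f
    using that
    by (simp add: Vector_Spaces.linear_iff Real_Vector_Spaces.linear_iff flip: V.scale_of_real)
  have bounded_linear: "bounded_linear f" if "Vector_Spaces.linear sc sc f" for f
    using V.linear_bounded_if_finite_span_scalar[OF F.finite_Basis F.span_Basis real_linear[OF that]] .

  obtain C where C: "C > 0" "\<And>n. onorm (S n) < C" using assms(4) by blast
  have S_bound: "norm (S n v) \<le> C * norm v" for n v
    using onorm[OF bounded_linear[OF S_lin], of n v] C(2)[of n]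
    by (meson less_imp_le mult_right_mono norm_ge_zero order_trans)

  define A where "A = orbit_map S"
  define e where "e n x = orbit_vector S n x" for n x
  have A_lin: "Vector_Spaces.linear sc sc (A n)" and A_bij: "bij (A n)" for n
    unfolding A_def using V.linear_bij_orbit_map[OF S_lin S_bij] by auto
  have A_step: "S n (A n x) = A (n - 1) x" for n x
    unfolding A_def using V.linear_bij_comp_between[OF S_lin S_bij]
    by (intro orbit_map_step S_bij) auto
  \<comment> \<open>Nonvanishing is essential: the orbit vectors are normalised by \<open>norm (A n x)\<close>.\<close>
  have A_nz: "A n x \<noteq> 0" if "x \<in> E" for n x
  proof
    assume "A n x = 0"
    moreover have "A n 0 = 0"
      using A_lin[of n] unfolding linear_iff_module_hom by (rule module_hom.zero)
    ultimately have "x = 0" using A_bij[of n] by (metis bij_is_inj injD)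
    then show False using that F.independent_Basis V.dependent_zero by blast
  qed
  have e_eq: "e n x = sc (of_real (inverse (norm (A n x)))) (A n x)" for n x
    by (simp add: e_def A_def orbit_vector_eq V.scale_of_real del: of_real_inverse)
  have A_eq: "A n x = sc (of_real (norm (A n x))) (e n x)" if "x \<in> E" for n x
    using A_nz[OF that, of n] by (simp add: e_eq flip: of_real_mult)
  have unit: "norm (e n x) = 1" if "x \<in> E" for n x
    using A_nz[OF that, of n] by (simp add: e_eq V.norm_scale norm_inverse)

  have span: "V.span (e n ` E) = UNIV" for n
  proof -
    have "A n ` E \<subseteq> V.span (e n ` E)"
    proof (rule image_subsetI)
      fix x assume "x \<in> E"
      then show "A n x \<in> V.span (e n ` E)"
        by (subst A_eq) (auto intro!: V.span_scale intro: V.span_base)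
    qed
    then have "V.span (A n ` E) \<subseteq> V.span (e n ` E)"
      by (metis V.span_mono V.span_span)
    moreover have "V.span (A n ` E) = A n ` V.span E"
      using A_lin[of n] unfolding linear_iff_module_hom by (rule module_hom.span_image)
    moreover have "A n ` V.span E = UNIV" using A_bij[of n] F.span_Basis by (simp add: bij_is_surj)
    ultimately show ?thesis by auto
  qed
  note basis = F.basis_if_spans_Basis_image[OF span]
  define c where "c n x v = V.representation (e n ` E) v (e n x)" for n x v
  have expand: "(\<Sum>x\<in>E. sc (c n x v) (e n x)) = v" for n v
  proof -
    have "(\<Sum>x\<in>E. sc (c n x v) (e n x)) =
        (\<Sum>b\<in>e n ` E. sc (V.representation (e n ` E) v b) b)"
      by (simp add: c_def sum.reindex[OF basis(2)])
    also have "\<dots> = v"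
      using basis(1) span F.finite_Basis by (intro V.sum_representation_eq) auto
    finally show ?thesis .
  qed
  have unique: "c n x (\<Sum>y\<in>E. sc (a y) (e n y)) = a x" if x: "x \<in> E" for n x a
  proof -
    have "c n x (\<Sum>y\<in>E. sc (a y) (e n y)) = (\<Sum>y\<in>E. a y * (if e n x = e n y then 1 else 0))"
      by (simp add: c_def V.representation_sum V.representation_scale V.representation_basis
          basis(1) span)
    also have "\<dots> = (\<Sum>y\<in>E. if x = y then a y else 0)"
      using x inj_onD[OF basis(2)] by (intro sum.cong) auto
    also have "\<dots> = a x" using x F.finite_Basis by simp
    finally show ?thesis .
  qed

  obtain M where M: "\<And>n b. b \<in> e n ` E \<Longrightarrow> onorm (coordinate_projection sc (e n ` E) b) \<le> M"
    using assms(5) unfolding has_bounded_projections_def bdd_above_def e_def by blast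
  \<comment> \<open>The absolute value is there because \<open>M\<close> may be negative when \<open>E\<close> is empty.\<close>
  have coord: "norm (c n x v) \<le> \<bar>M\<bar> * norm v" if x: "x \<in> E" for n x v
  proof -
    let ?P = "coordinate_projection sc (e n ` E) (e n x)"
    have "Vector_Spaces.linear sc sc ?P"
      by (simp add: Vector_Spaces.linear_iff V.vector_space_axioms coordinate_projection_def
          V.representation_add V.representation_scale basis(1) span V.scale_left_distrib)
    then have "norm (?P v) \<le> onorm ?P * norm v" by (intro onorm bounded_linear)
    also have "\<dots> \<le> \<bar>M\<bar> * norm v" using M[of "e n x" n] x by (intro mult_right_mono) auto
    also have "norm (?P v) = norm (c n x v)"
      by (simp add: coordinate_projection_def c_def V.norm_scale unit[OF x])
    finally show ?thesis .
  qed
  have move: "S n (e n x) = sc (of_real (weight S x n)) (e (n - 1) x)" if "x \<in> E" for n x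
  proof -
    have "S n (e n x) = sc (of_real (inverse (norm (A n x)))) (A (n - 1) x)"
      using S_lin[of n] by (simp add: e_eq Vector_Spaces.linear_iff A_step)
    also have "\<dots> = sc (of_real (weight S x n)) (e (n - 1) x)"
      by (subst A_eq[OF that]) (simp add: weight_eq A_def field_simps)
    finally show ?thesis .
  qed
  show ?thesis
    using F.finite_Basis assms(6) unit expand unique abs_ge_zero coord S_lin
      less_imp_le[OF C(1)] S_bound move
    by (rule V.shift_conjugate_if_moving_frame)
qed

end
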